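(* Let $f_0,F:\mathbb{R}^n\times\mathbb{R}^d\to\mathbb{R}$ be twice continuously differentiable functions. For $w\in\mathbb{R}^d$ put $C(w)=\{x\in\mathbb{R}^n\mid F(x,w)\le 0\}$ and $$S(w)=\{x\in\mathbb{R}^n\mid 0\in\nabla_xf_0(x,w)+N_{C(w)}(x)\}.$$ Let $\bar w\in\mathbb{R}^d$ and $\bar x\in S(\bar w)$. Suppose that $F(\bar x,\bar w)=0$, that $\nabla_xF(\bar x,\bar w)\neq 0$, and that the Lagrange multiplier $\lambda$ corresponding to the stationary point $\bar x\in S(\bar w)$ (the unique $\lambda\ge 0$ with $\nabla_xf_0(\bar x,\bar w)+\lambda\nabla_xF(\bar x,\bar w)=0$) is positive. Put $$A_1=\left[\nabla^2_{xx}f_0(\bar x,\bar w)+\lambda\nabla^2_{xx}F(\bar x,\bar w)\quad \nabla_xF(\bar x,\bar w)\right]\in\mathbb{R}^{n\times(n+1)},$$ $$A_2=\left[\nabla^2_{wx}f_0(\bar x,\bar w)+\lambda\nabla^2_{wx}F(\bar x,\bar w)\quad \nabla_wF(\bar x,\bar w)\right]\in\mathbb{R}^{d\times(n+1)}.$$ If $$\ker A_1\cap\ker A_2\cap\left(\ker\nabla_xF(\bar x,\bar w)\times\mathbb{R}\right)=\{(0,0)\},$$ then $S$ is locally Lipschitz-like around $(\bar w,\bar x)$ if and only if $$\ker A_1\cap\left(\ker\nabla_xF(\bar x,\bar w)\times\mathbb{R}\right)\subset\ker A_2.$$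
   Context: Fréchet normal cone: for $\Omega\subset\mathbb{R}^s$ and $\bar v\in\Omega$, $\widehat N_\Omega(\bar v)=\{v'\in\mathbb{R}^s\mid \limsup_{v\to\bar v,\,v\in\Omega}\frac{\langle v',v-\bar v\rangle}{\|v-\bar v\|}\le 0\}$, and $\widehat N_\Omega(\bar v)=\emptyset$ if $\bar v\notin\Omega$. Mordukhovich (limiting) normal cone, for $\Omega$ locally closed around $\bar v\in\Omega$: $N_\Omega(\bar v)$ is the set of all $v'$ for which there are sequences $v_k\to\bar v$, $v'_k\to v'$ with $v'_k\in\widehat N_\Omega(v_k)$ for all $k$; $N_\Omega(\bar v)=\emptyset$ if $\bar v\notin\Omega$. The map $S:\mathbb{R}^d\rightrightarrows\mathbb{R}^n$ is the stationary point set map of the parametric problem of minimizing $f_0(x,w)$ subject to $F(x,w)\le 0$. Under $F(\bar x,\bar w)=0$, $\nabla_xF(\bar x,\bar w)\ne 0$ and $\bar x\in S(\bar w)$, the multiplier $\lambda$ exists and is unique. For a function $h(x,w)$, $\nabla^2_{xx}h$ is the $n\times n$ Hessian in $x$ and $\nabla^2_{wx}h$ is the $d\times n$ matrix with entries $\partial^2h/\partial w_i\partial x_j$. In $A_1,A_2$ the gradients $\nabla_xF(\bar x,\bar w)$ and $\nabla_wF(\bar x,\bar w)$ are column vectors; $A_1,A_2$ act on pairs $(v'_1,\gamma)\in\mathbb{R}^n\times\mathbb{R}$. $\ker\nabla_xF(\bar x,\bar w)=\{v'_1\in\mathbb{R}^n\mid\langle\nabla_xF(\bar x,\bar w),v'_1\rangle=0\}$.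 A multifunction $S:\mathbb{R}^d\rightrightarrows\mathbb{R}^n$ is locally Lipschitz-like around $(\bar w,\bar x)\in\mathrm{gph}\,S=\{(w,x)\mid x\in S(w)\}$ if there exist $\ell>0$ and neighborhoods $U$ of $\bar x$ and $V$ of $\bar w$ such that $S(w')\cap U\subset S(w)+\ell\|w'-w\|\bar B$ for all $w,w'\in V$, where $\bar B$ is the closed unit ball of $\mathbb{R}^n$. *)

theory Defs
  imports "HOL-Analysis.Analysis"
begin

definition C2 :: "('a::real_normed_vector \<Rightarrow> 'b::real_normed_vector) \<Rightarrow> bool" where
  "C2 f \<longleftrightarrow> (\<exists>(f' :: 'a \<Rightarrow> 'a \<Rightarrow>\<^sub>L 'b) (f'' :: 'a \<Rightarrow> 'a \<Rightarrow>\<^sub>L 'a \<Rightarrow>\<^sub>L 'b).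
     (\<forall>x. (f has_derivative blinfun_apply (f' x)) (at x)) \<and>
     (\<forall>x. (f' has_derivative blinfun_apply (f'' x)) (at x)) \<and>
     continuous_on UNIV f'')"

(* Unspecified where f is not differentiable. *)
definition gradient :: "('a::real_inner \<Rightarrow> real) \<Rightarrow> 'a \<Rightarrow> 'a" where
  "gradient f x = (THE D. GDERIV f x :> D)"

definition grad_x :: "((real^'n) \<times> (real^'d) \<Rightarrow> real) \<Rightarrow> real^'n \<Rightarrow> real^'d \<Rightarrow> real^'n" where
  "grad_x h x w = gradient (\<lambda>u. h (u, w)) x"

definition grad_w :: "((real^'n) \<times> (real^'d) \<Rightarrow> real) \<Rightarrow> real^'n \<Rightarrow> real^'d \<Rightarrow> real^'d" where
  "grad_w h x w = gradient (\<lambda>u. h (x, u)) w"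

definition hess_xx :: "((real^'n) \<times> (real^'d) \<Rightarrow> real) \<Rightarrow> real^'n \<Rightarrow> real^'d \<Rightarrow> real^'n^'n" where
  "hess_xx h x w = jacobian (\<lambda>u. grad_x h u w) (at x)"

(* The Jacobian of the x-gradient with respect to w is n by d; its transpose is the
   d by n matrix with entry (i, j) equal to the derivative of dh/dx_j in direction w_i. *)
definition hess_wx :: "((real^'n) \<times> (real^'d) \<Rightarrow> real) \<Rightarrow> real^'n \<Rightarrow> real^'d \<Rightarrow> real^'n^'d" where
  "hess_wx h x w = transpose (jacobian (\<lambda>u. grad_x h x u) (at w))"

(* The block matrix [M c], acting on pairs (v, g) in R^n x R. *)
definition append_column :: "real^'n^'m \<Rightarrow> real^'m \<Rightarrow> (real^'n) \<times> real \<Rightarrow> real^'m" where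
  "append_column M c = (\<lambda>(v, g). M *v v + g *\<^sub>R c)"

definition kernel :: "('a \<Rightarrow> 'b::zero) \<Rightarrow> 'a set" where
  "kernel A = {v. A v = 0}"

(* The filter "at v within \<Omega>" omits v itself, and at an isolated point of \<Omega>
   the upper limit is minus infinity. *)
definition frechet_normal_cone :: "'a::real_inner set \<Rightarrow> 'a \<Rightarrow> 'a set" where
  "frechet_normal_cone \<Omega> v =
     (if v \<in> \<Omega>
      then {v'. Limsup (at v within \<Omega>) (\<lambda>u. ereal (inner v' (u - v) / norm (u - v))) \<le> 0}
      else {})"

(* Intended for sets that are locally closed around v. *)
definition limiting_normal_cone :: "'a::real_inner set \<Rightarrow> 'a \<Rightarrow> 'a set" where
  "limiting_normal_cone \<Omega> v =
     (if v \<in> \<Omega>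
      then {v'. \<exists>vs vs'. vs \<longlonglongrightarrow> v \<and> vs' \<longlonglongrightarrow> v' \<and>
                 (\<forall>k::nat. vs' k \<in> frechet_normal_cone \<Omega> (vs k))}
      else {})"

definition feasible_set :: "((real^'n) \<times> (real^'d) \<Rightarrow> real) \<Rightarrow> real^'d \<Rightarrow> (real^'n) set" where
  "feasible_set F w = {x. F (x, w) \<le> 0}"

definition stationary_points ::
    "((real^'n) \<times> (real^'d) \<Rightarrow> real) \<Rightarrow> ((real^'n) \<times> (real^'d) \<Rightarrow> real) \<Rightarrow> real^'d \<Rightarrow> (real^'n) set" where
  "stationary_points f0 F w =
     {x. 0 \<in> (\<lambda>v. grad_x f0 x w + v) ` limiting_normal_cone (feasible_set F w) x}"

definition lagrange_multiplier ::
    "((real^'n) \<times> (real^'d) \<Rightarrow> real) \<Rightarrow> ((real^'n) \<times> (real^'d) \<Rightarrow> real) \<Rightarrow> real^'n \<Rightarrow> real^'d \<Rightarrow> real \<Rightarrow> bool"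
  where
  "lagrange_multiplier f0 F x w l \<longleftrightarrow> l \<ge> 0 \<and> grad_x f0 x w + l *\<^sub>R grad_x F x w = 0"

definition lipschitz_like_around ::
    "('w::real_normed_vector \<Rightarrow> 'x::real_normed_vector set) \<Rightarrow> 'w \<Rightarrow> 'x \<Rightarrow> bool" where
  "lipschitz_like_around S wbar xbar \<longleftrightarrow>
     (\<exists>l>0. \<exists>U V. open U \<and> xbar \<in> U \<and> open V \<and> wbar \<in> V \<and>
        (\<forall>w\<in>V. \<forall>w'\<in>V.
           S w' \<inter> U \<subseteq> {x + (l * norm (w' - w)) *\<^sub>R b | x b. x \<in> S w \<and> b \<in> cball 0 1}))"

end

theory Submission
  imports Defs
begin

text \<open>Near the base point, stationarity of \<open>x\<close> for \<open>w\<close> means \<open>grad_x f0 + m *\<^sub>R grad_x F = 0\<close> and \<open>F = 0\<close>,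
  with \<open>m\<close> the least-squares multiplier, which is differentiable in \<open>(x, w)\<close>.

  Suppose \<open>S\<close> is Lipschitz-like, let \<open>(v, c)\<close> be in \<open>kernel A1\<close> with \<open>v\<close> orthogonal to \<open>grad_x F\<close>, and put
  \<open>q = A2 (v, c)\<close>. By symmetry of the Hessian, \<open>inner (grad_x f0 + m *\<^sub>R grad_x F) v + c * F\<close> has
  derivative \<open>(\<xi>, \<omega>) \<mapsto> inner q \<omega>\<close> at the base point, while it vanishes on the graph of \<open>S\<close>. The graph
  contains points \<open>(x, wbar + t *\<^sub>R q)\<close> at distance \<open>O(t)\<close> from the base point, hence \<open>inner q q = 0\<close>.

  Conversely, with the kernel condition the inclusion says that the symmetric matrix of the linearised
  optimality system is nonsingular, and the inverse function theorem makes \<open>S\<close> locally a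
  single-valued Lipschitz map.\<close>

section \<open>Symmetry of second derivatives\<close>

text \<open>The second difference is the increment over \<open>[0, t]\<close> of the function of
  \<open>s\<close> called \<open>p\<close> below. The mean value theorem turns it into a difference
  of two values of \<open>f'\<close>, which the first-order expansion of \<open>f'\<close> at
  \<open>x\<close> determines up to \<open>o(t)\<close>.\<close>

lemma second_difference_approx:
  fixes f :: "'a::real_normed_vector \<Rightarrow> real"
    and f' :: "'a \<Rightarrow> 'a \<Rightarrow>\<^sub>L real" and f'' :: "'a \<Rightarrow>\<^sub>L 'a \<Rightarrow>\<^sub>L real"
  assumes f: "\<And>y. (f has_derivative blinfun_apply (f' y)) (at y)"
    and f': "(f' has_derivative blinfun_apply f'') (at x)"
    and "e > 0"
  shows "\<forall>\<^sub>F t in at_right 0.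
    \<bar>f (x + t *\<^sub>R a + t *\<^sub>R b) - f (x + t *\<^sub>R a) - f (x + t *\<^sub>R b) + f x
      - t\<^sup>2 * blinfun_apply (blinfun_apply f'' b) a\<bar> \<le> e * t\<^sup>2"
proof -
  \<comment> \<open>The two remainders below contribute
    \<open>2 * (norm a + norm b) * norm a\<close>; adding 1 keeps \<open>M\<close> positive when
    this vanishes.\<close>
  define M where "M = 2 * (norm a + norm b) * norm a + 1"
  have M: "M > 0" unfolding M_def by (simp add: add_nonneg_pos)
  have "e / M > 0" using \<open>e > 0\<close> M by simp
  then obtain d where "d > 0" and d: "\<And>y. norm (y - x) < d \<Longrightarrow>
      norm (f' y - f' x - blinfun_apply f'' (y - x)) \<le> e / M * norm (y - x)"
    using f' unfolding has_derivative_at_alt by blast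
  \<comment> \<open>For \<open>t < r\<close> both points at which \<open>f'\<close> is expanded lie
    within \<open>d\<close> of \<open>x\<close>.\<close>
  define r where "r = d / (norm a + norm b + 1)"
  have "r > 0" unfolding r_def using \<open>d > 0\<close> by (simp add: add_nonneg_pos)
  show ?thesis
  proof (rule eventually_at_rightI[OF _ \<open>r > 0\<close>])
    fix t assume "t \<in> {0<..<r}"
    then have t: "0 < t" "t < r" by auto
    have td: "t * (norm a + norm b) < d"
    proof -
      have "t * (norm a + norm b + 1) < d"
        using t unfolding r_def by (simp add: pos_less_divide_eq add_nonneg_pos)
      then show ?thesis using t by (simp add: algebra_simps)
    qed
    define p where "p s = f (x + s *\<^sub>R a + t *\<^sub>R b) - f (x + s *\<^sub>R a)" for s
    have p': "(p has_derivative (\<lambda>h. h * (f' (x + s *\<^sub>R a + t *\<^sub>R b) a - f' (x + s *\<^sub>R a) a))) (at s)" for s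
    proof -
      have 1: "((\<lambda>s. f (x + s *\<^sub>R a + t *\<^sub>R b)) has_derivative
          (\<lambda>h. f' (x + s *\<^sub>R a + t *\<^sub>R b) (h *\<^sub>R a))) (at s)"
        by (rule has_derivative_compose[OF _ f]) (auto intro!: derivative_eq_intros)
      have 2: "((\<lambda>s. f (x + s *\<^sub>R a)) has_derivative
          (\<lambda>h. f' (x + s *\<^sub>R a) (h *\<^sub>R a))) (at s)"
        by (rule has_derivative_compose[OF _ f]) (auto intro!: derivative_eq_intros)
      show ?thesis
        unfolding p_def using has_derivative_diff[OF 1 2]
        by (simp add: blinfun.scaleR_right algebra_simps)
    qed
    obtain s where s: "s \<in> {0<..<t}" and
      ps: "p t - p 0 = (t - 0) * (f' (x + s *\<^sub>R a + t *\<^sub>R b) a - f' (x + s *\<^sub>R a) a)"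
      using mvt_simple[OF t(1), of p "\<lambda>s h. h * (f' (x + s *\<^sub>R a + t *\<^sub>R b) a - f' (x + s *\<^sub>R a) a)"]
        p' has_derivative_at_withinI by blast
    have n1: "norm (s *\<^sub>R a + t *\<^sub>R b) \<le> t * (norm a + norm b)"
    proof -
      have "norm (s *\<^sub>R a + t *\<^sub>R b) \<le> s * norm a + t * norm b"
        using norm_triangle_ineq[of "s *\<^sub>R a" "t *\<^sub>R b"] s t by simp
      also have "\<dots> \<le> t * norm a + t * norm b" using s by (simp add: mult_right_mono)
      finally show ?thesis by (simp add: algebra_simps)
    qed
    have n2: "norm (s *\<^sub>R a) \<le> t * (norm a + norm b)"
    proof -
      have "norm (s *\<^sub>R a) = s * norm a" using s by simp
      also have "\<dots> \<le> t * (norm a + norm b)" using s by (intro mult_mono) auto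
      finally show ?thesis .
    qed
    define E1 where "E1 = f' (x + s *\<^sub>R a + t *\<^sub>R b) - f' x - f'' (s *\<^sub>R a + t *\<^sub>R b)"
    define E2 where "E2 = f' (x + s *\<^sub>R a) - f' x - f'' (s *\<^sub>R a)"
    have e1: "norm E1 \<le> e / M * (t * (norm a + norm b))"
    proof -
      have "norm E1 \<le> e / M * norm (s *\<^sub>R a + t *\<^sub>R b)"
        using d[of "x + (s *\<^sub>R a + t *\<^sub>R b)"] n1 td unfolding E1_def by (simp add: add.assoc)
      also have "\<dots> \<le> e / M * (t * (norm a + norm b))"
        using n1 \<open>e / M > 0\<close> by (intro mult_left_mono) auto
      finally show ?thesis .
    qed
    have e2: "norm E2 \<le> e / M * (t * (norm a + norm b))"
    proof -
      have "norm E2 \<le> e / M * norm (s *\<^sub>R a)"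
        using d[of "x + s *\<^sub>R a"] le_less_trans[OF n2 td] unfolding E2_def by simp
      also have "\<dots> \<le> e / M * (t * (norm a + norm b))"
        using n2 \<open>e / M > 0\<close> by (intro mult_left_mono) auto
      finally show ?thesis .
    qed
    \<comment> \<open>The linear parts differ by \<open>f'' (t *\<^sub>R b)\<close> whatever
      \<open>s\<close> is, so the unknown intermediate point enters only through the
      remainders.\<close>
    have eq: "f' (x + s *\<^sub>R a + t *\<^sub>R b) a - f' (x + s *\<^sub>R a) a = t * f'' b a + (E1 - E2) a"
      unfolding E1_def E2_def
      by (simp add: blinfun.diff_left blinfun.add_left blinfun.add_right blinfun.scaleR_right blinfun.scaleR_left)
    have "\<bar>(E1 - E2) a\<bar> \<le> norm (E1 - E2) * norm a"
      using norm_blinfun[of "E1 - E2" a] by simp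
    also have "\<dots> \<le> (2 * (e / M * (t * (norm a + norm b)))) * norm a"
      by (intro mult_right_mono order_trans[OF norm_triangle_ineq4 add_mono[OF e1 e2, folded mult_2]]) auto
    also have "\<dots> = e / M * t * (M - 1)" unfolding M_def by (simp add: algebra_simps)
    also have "\<dots> \<le> e / M * t * M" using \<open>e / M > 0\<close> t by (intro mult_left_mono mult_nonneg_nonneg) auto
    also have "\<dots> = e * t" using M by simp
    finally have err: "\<bar>(E1 - E2) a\<bar> \<le> e * t" .
    have "f (x + t *\<^sub>R a + t *\<^sub>R b) - f (x + t *\<^sub>R a) - f (x + t *\<^sub>R b) + f x = p t - p 0"
      unfolding p_def by simp
    also have "\<dots> = t\<^sup>2 * f'' b a + t * (E1 - E2) a"
      unfolding ps eq by (simp add: algebra_simps power2_eq_square)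
    finally show "\<bar>f (x + t *\<^sub>R a + t *\<^sub>R b) - f (x + t *\<^sub>R a) - f (x + t *\<^sub>R b) + f x
      - t\<^sup>2 * f'' b a\<bar> \<le> e * t\<^sup>2"
      using mult_left_mono[OF err, of t] t by (simp add: abs_mult power2_eq_square algebra_simps)
  qed
qed

text \<open>Exchanging \<open>a\<close> and \<open>b\<close> does not change the second difference,
  so \<open>t\<^sup>2 * f'' b a\<close> and \<open>t\<^sup>2 * f'' a b\<close> approximate the same
  number up to \<open>o(t\<^sup>2)\<close>.\<close>

lemma second_derivative_symmetric:
  fixes f :: "'a::real_normed_vector \<Rightarrow> real"
    and f' :: "'a \<Rightarrow> 'a \<Rightarrow>\<^sub>L real" and f'' :: "'a \<Rightarrow>\<^sub>L 'a \<Rightarrow>\<^sub>L real"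
  assumes f: "\<And>y. (f has_derivative blinfun_apply (f' y)) (at y)"
    and f': "(f' has_derivative blinfun_apply f'') (at x)"
  shows "blinfun_apply (blinfun_apply f'' a) b = blinfun_apply (blinfun_apply f'' b) a"
proof -
  have "\<bar>f'' a b - f'' b a\<bar> \<le> 0 + e" if "e > 0" for e
  proof -
    have "e / 2 > 0" using that by simp
    note ev = second_difference_approx[OF f f' this]
    have "\<forall>\<^sub>F t in at_right (0::real). \<bar>f'' a b - f'' b a\<bar> \<le> e"
      using ev[of a b] ev[of b a] eventually_at_right_less[of 0]
    proof eventually_elim
      case (elim t)
      have "t\<^sup>2 * \<bar>f'' a b - f'' b a\<bar> = \<bar>t\<^sup>2 * f'' a b - t\<^sup>2 * f'' b a\<bar>"
        by (simp add: abs_mult flip: right_diff_distrib)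
      also have "\<dots> \<le> t\<^sup>2 * e"
      proof -
        have "\<bar>q - p\<bar> \<le> 2 * c"
          if "\<bar>A - B - C + D - p\<bar> \<le> c" "\<bar>A - C - B + D - q\<bar> \<le> c"
          for A B C D c p q :: real using that by linarith
        from this[OF elim(1) elim(2)[unfolded add.assoc add.commute[of "t *\<^sub>R b"], folded add.assoc]]
        show ?thesis by (simp add: mult.commute)
      qed
      finally show ?case using elim(3) by simp
    qed
    then show ?thesis by (simp add: eventually_const)
  qed
  then have "\<bar>f'' a b - f'' b a\<bar> \<le> 0" by (rule field_le_epsilon)
  then show ?thesis by simp
qed

section \<open>Frechet and limiting normals to sublevel sets\<close>

text \<open>Clearing the denominator replaces the extended-real upper limit by the inequality that
  the later estimates use. This is legitimate because the filter omits \<open>x\<close>.\<close>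

lemma frechet_normal_cone_iff:
  "v \<in> frechet_normal_cone \<Omega> x \<longleftrightarrow>
     x \<in> \<Omega> \<and> (\<forall>e>0. \<forall>\<^sub>F u in at x within \<Omega>. inner v (u - x) \<le> e * norm (u - x))"
proof (cases "x \<in> \<Omega>")
  case True
  let ?q = "\<lambda>u. inner v (u - x) / norm (u - x)"
  have "Limsup (at x within \<Omega>) (\<lambda>u. ereal (?q u)) \<le> 0 \<longleftrightarrow>
      (\<forall>y>0. \<forall>\<^sub>F u in at x within \<Omega>. ereal (?q u) < y)"
    by (rule Limsup_le_iff)
  also have "\<dots> \<longleftrightarrow> (\<forall>e>0. \<forall>\<^sub>F u in at x within \<Omega>. ?q u \<le> e)"
  proof safe
    fix e :: real assume "\<forall>y>0. \<forall>\<^sub>F u in at x within \<Omega>. ereal (?q u) < y" "0 < e"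
    then have "\<forall>\<^sub>F u in at x within \<Omega>. ereal (?q u) < ereal e"
      by (metis ereal_less(2))
    then show "\<forall>\<^sub>F u in at x within \<Omega>. ?q u \<le> e"
      by (rule eventually_mono) simp
  next
    fix y :: ereal assume *: "\<forall>e>0. \<forall>\<^sub>F u in at x within \<Omega>. ?q u \<le> e" and "0 < y"
    then obtain e where e: "0 < ereal e" "ereal e < y"
      using ereal_dense2 by blast
    with * have "\<forall>\<^sub>F u in at x within \<Omega>. ?q u \<le> e" by simp
    then show "\<forall>\<^sub>F u in at x within \<Omega>. ereal (?q u) < y"
      by (rule eventually_mono) (use e in \<open>metis ereal_less_eq(3) le_less_trans\<close>)
  qed
  also have "\<dots> \<longleftrightarrow> (\<forall>e>0. \<forall>\<^sub>F u in at x within \<Omega>. inner v (u - x) \<le> e * norm (u - x))"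
  proof -
    have "(\<forall>\<^sub>F u in at x within \<Omega>. ?q u \<le> e) \<longleftrightarrow>
        (\<forall>\<^sub>F u in at x within \<Omega>. inner v (u - x) \<le> e * norm (u - x))" for e
      unfolding eventually_at_filter
      by (rule eventually_cong[OF always_eventually]) (auto simp: field_simps)
    then show ?thesis by simp
  qed
  finally show ?thesis using True unfolding frechet_normal_cone_def by simp
qed (simp add: frechet_normal_cone_def)

text \<open>Along the ray both sides of the defining inequality are proportional to
  \<open>t\<close>. Dividing by \<open>t\<close>, with the tolerance scaled by
  \<open>norm d\<close>, leaves \<open>inner v d \<le> e\<close> for every positive
  \<open>e\<close>.\<close>

lemma frechet_normal_inner_nonpos:
  assumes v: "v \<in> frechet_normal_cone \<Omega> x"
    and d: "\<forall>\<^sub>F t in at_right 0. x + t *\<^sub>R d \<in> \<Omega>"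
  shows "inner v d \<le> 0"
proof (cases "d = 0")
  case False
  have lim: "filterlim (\<lambda>t. x + t *\<^sub>R d) (at x within \<Omega>) (at_right 0)"
    unfolding filterlim_at
  proof
    show "\<forall>\<^sub>F t in at_right 0. x + t *\<^sub>R d \<in> \<Omega> \<and> x + t *\<^sub>R d \<noteq> x"
      using d eventually_at_right_less[of 0] by eventually_elim (use False in auto)
    show "((\<lambda>t. x + t *\<^sub>R d) \<longlongrightarrow> x) (at_right 0)"
      by (auto intro!: tendsto_eq_intros)
  qed
  have "inner v d \<le> 0 + e" if "e > 0" for e
  proof -
    have "e / norm d > 0" using that False by simp
    then have "\<forall>\<^sub>F u in at x within \<Omega>. inner v (u - x) \<le> e / norm d * norm (u - x)"
      using v unfolding frechet_normal_cone_iff by blast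
    with lim have "\<forall>\<^sub>F t in at_right 0. inner v (t *\<^sub>R d) \<le> e / norm d * norm (t *\<^sub>R d)"
      by (auto simp: filterlim_iff)
    then have "\<forall>\<^sub>F t in at_right (0::real). inner v d \<le> e"
      using eventually_at_right_less[of 0] by eventually_elim (use False in simp)
    then show ?thesis by (simp add: eventually_const)
  qed
  then show ?thesis by (rule field_le_epsilon)
qed simp

text \<open>At an interior point every direction is feasible, in particular \<open>v\<close> itself,
  which gives \<open>inner v v \<le> 0\<close>.\<close>

lemma frechet_normal_interior:
  assumes "v \<in> frechet_normal_cone \<Omega> x" "x \<in> interior \<Omega>"
  shows "v = 0"
proof -
  have "\<forall>\<^sub>F t in at_right 0. x + t *\<^sub>R v \<in> interior \<Omega>"
  proof (rule topological_tendstoD[OF _ open_interior assms(2)])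
    show "((\<lambda>t. x + t *\<^sub>R v) \<longlongrightarrow> x) (at_right 0)"
      by (auto intro!: tendsto_eq_intros)
  qed
  then have "\<forall>\<^sub>F t in at_right 0. x + t *\<^sub>R v \<in> \<Omega>"
    by (rule eventually_mono) (use interior_subset in blast)
  then have "inner v v \<le> 0" by (rule frechet_normal_inner_nonpos[OF assms(1)])
  then show ?thesis by (metis inner_gt_zero_iff not_le)
qed

text \<open>No sign condition on \<open>h x\<close>: at interior points of the sublevel set the multiplier is \<open>0\<close>.\<close>

lemma frechet_normal_sublevel:
  assumes h: "GDERIV h x :> a" and "a \<noteq> 0"
    and v: "v \<in> frechet_normal_cone {u. h u \<le> 0} x"
  shows "v = (inner v a / inner a a) *\<^sub>R a" "inner v a \<ge> 0"
proof -
  have hx: "h x \<le> 0" using v by (simp add: frechet_normal_cone_iff)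
  \<comment> \<open>Since \<open>h x \<le> 0\<close>, short steps along a strict descent direction
    of \<open>h\<close> stay in the sublevel set.\<close>
  have desc: "inner v d \<le> 0" if "inner a d < 0" for d
  proof (rule frechet_normal_inner_nonpos[OF v])
    have "((\<lambda>t. h (x + t *\<^sub>R d)) has_derivative (\<lambda>t. inner (t *\<^sub>R d) a)) (at 0)"
      by (rule has_derivative_compose[of "\<lambda>t. x + t *\<^sub>R d" "\<lambda>t. t *\<^sub>R d"])
        (use h in \<open>auto intro!: derivative_eq_intros simp: gderiv_def\<close>)
    then have "((\<lambda>t. h (x + t *\<^sub>R d)) has_real_derivative inner a d) (at 0)"
      unfolding has_field_derivative_def by (simp add: inner_commute mult_commute_abs)
    from DERIV_neg_dec_right[OF this that]
    obtain r where "r > 0" and r: "\<And>t. 0 < t \<Longrightarrow> t < r \<Longrightarrow> h (x + t *\<^sub>R d) < h x" by auto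
    show "\<forall>\<^sub>F t in at_right 0. x + t *\<^sub>R d \<in> {u. h u \<le> 0}"
      by (rule eventually_at_rightI[OF _ \<open>r > 0\<close>]) (use r hx in force)
  qed
  have aa: "inner a a > 0" using \<open>a \<noteq> 0\<close> by simp
  show "inner v a \<ge> 0" using desc[of "- a"] aa by simp
  define l where "l = inner v a / inner a a"
  define r where "r = v - l *\<^sub>R a"
  have ra: "inner a r = 0" using aa unfolding r_def l_def by (simp add: inner_diff inner_commute)
  have vr: "inner v r = inner r r"
    using ra unfolding r_def by (simp add: inner_diff inner_commute algebra_simps)
  \<comment> \<open>The part \<open>r\<close> of \<open>v\<close> orthogonal to \<open>a\<close> is
    only a limit of descent directions. The test is made with \<open>r - c *\<^sub>R a\<close>,
    where \<open>c\<close> is so small that the extra term \<open>c * inner v a\<close> is at most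
    \<open>e\<close>.\<close>
  have "inner r r \<le> 0 + e" if "e > 0" for e
  proof -
    define c where "c = e / (\<bar>inner v a\<bar> + 1)"
    have c: "c > 0" unfolding c_def using that by simp
    have "inner a (r - c *\<^sub>R a) < 0" using ra aa c by (simp add: inner_diff)
    from desc[OF this] have "inner r r \<le> c * inner v a" by (simp add: inner_diff vr)
    also have "\<dots> \<le> c * (\<bar>inner v a\<bar> + 1)" using c by (intro mult_left_mono) auto
    also have "\<dots> = e" unfolding c_def by simp
    finally show ?thesis by simp
  qed
  then have "inner r r \<le> 0" by (rule field_le_epsilon)
  then have "r = 0" by (metis inner_gt_zero_iff not_le)
  then show "v = (inner v a / inner a a) *\<^sub>R a" unfolding r_def l_def by simp
qed

text \<open>On the sublevel set \<open>h u \<le> 0 = h x\<close>, so the linear term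
  \<open>inner a (u - x)\<close> is at most the remainder of the first-order expansion of
  \<open>h\<close>.\<close>

lemma multiplier_in_frechet_normal_cone:
  assumes h: "GDERIV h x :> a" and "h x = 0" "l \<ge> 0"
  shows "l *\<^sub>R a \<in> frechet_normal_cone {u. h u \<le> 0} x"
  unfolding frechet_normal_cone_iff
proof (intro conjI allI impI)
  fix e :: real assume "e > 0"
  \<comment> \<open>The divisor \<open>l + 1\<close> absorbs the later factor \<open>l\<close> and
    stays positive for \<open>l = 0\<close>.\<close>
  then have "e / (l + 1) > 0" using \<open>l \<ge> 0\<close> by simp
  then obtain d where "d > 0" and d: "\<And>y. norm (y - x) < d \<Longrightarrow>
      norm (h y - h x - inner (y - x) a) \<le> e / (l + 1) * norm (y - x)"
    using h unfolding gderiv_def has_derivative_at_alt by blast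
  show "\<forall>\<^sub>F u in at x within {u. h u \<le> 0}. inner (l *\<^sub>R a) (u - x) \<le> e * norm (u - x)"
    unfolding eventually_at
  proof (intro exI[of _ d] conjI ballI impI)
    fix u assume u: "u \<in> {u. h u \<le> 0}" "u \<noteq> x \<and> dist u x < d"
    have "inner a (u - x) \<le> e / (l + 1) * norm (u - x)"
      using d[of u] u \<open>h x = 0\<close> by (simp add: dist_norm inner_commute abs_le_iff)
    then have "l * inner a (u - x) \<le> l * (e / (l + 1) * norm (u - x))"
      using \<open>l \<ge> 0\<close> by (rule mult_left_mono)
    also have "\<dots> = (l / (l + 1)) * (e * norm (u - x))" by simp
    also have "\<dots> \<le> 1 * (e * norm (u - x))"
      using \<open>l \<ge> 0\<close> \<open>e > 0\<close> by (intro mult_right_mono) auto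
    finally show "inner (l *\<^sub>R a) (u - x) \<le> e * norm (u - x)" by simp
  qed (fact \<open>d > 0\<close>)
qed (use \<open>h x = 0\<close> in simp)

lemma frechet_subset_limiting:
  "frechet_normal_cone \<Omega> x \<subseteq> limiting_normal_cone \<Omega> x"
proof
  fix v assume v: "v \<in> frechet_normal_cone \<Omega> x"
  then have "x \<in> \<Omega>" by (simp add: frechet_normal_cone_iff)
  with v show "v \<in> limiting_normal_cone \<Omega> x"
    unfolding limiting_normal_cone_def
    by (auto intro: exI[of _ "\<lambda>_. x", OF exI[of _ "\<lambda>_. v"]])
qed

text \<open>The projection formula and the sign hold for the Frechet normals \<open>vs' k\<close>
  and pass to the limit, since \<open>a\<close> is continuous and nonzero at \<open>x\<close>. If
  \<open>h x < 0\<close>, the points \<open>vs k\<close> are eventually interior, so the normals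
  there vanish and \<open>v = 0\<close>.\<close>

lemma limiting_normal_sublevel:
  assumes h: "\<And>y. GDERIV h y :> a y" and a: "isCont a x" and "a x \<noteq> 0"
    and v: "v \<in> limiting_normal_cone {u. h u \<le> 0} x"
  shows "v = (inner v (a x) / inner (a x) (a x)) *\<^sub>R a x" "inner v (a x) \<ge> 0"
    "v \<noteq> 0 \<Longrightarrow> h x = 0"
proof -
  obtain vs vs' where vs: "vs \<longlonglongrightarrow> x" and vs': "vs' \<longlonglongrightarrow> v"
    and N: "\<And>k::nat. vs' k \<in> frechet_normal_cone {u. h u \<le> 0} (vs k)" and hx: "h x \<le> 0"
    using v by (auto simp: limiting_normal_cone_def split: if_splits)
  have as: "(\<lambda>k. a (vs k)) \<longlonglongrightarrow> a x" using isCont_tendsto_compose[OF a vs] .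
  then have ne: "\<forall>\<^sub>F k in sequentially. a (vs k) \<noteq> 0"
    using \<open>a x \<noteq> 0\<close> by (rule tendsto_imp_eventually_ne)
  have lim: "(\<lambda>k. (inner (vs' k) (a (vs k)) / inner (a (vs k)) (a (vs k))) *\<^sub>R a (vs k))
      \<longlonglongrightarrow> (inner v (a x) / inner (a x) (a x)) *\<^sub>R a x"
    using \<open>a x \<noteq> 0\<close> by (intro tendsto_intros as vs') auto
  have "\<forall>\<^sub>F k in sequentially. vs' k =
      (inner (vs' k) (a (vs k)) / inner (a (vs k)) (a (vs k))) *\<^sub>R a (vs k)"
    using ne by eventually_elim (rule frechet_normal_sublevel(1)[OF h _ N])
  from lim tendsto_cong[OF this] show "v = (inner v (a x) / inner (a x) (a x)) *\<^sub>R a x"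
    using vs' LIMSEQ_unique by blast
  have "\<forall>\<^sub>F k in sequentially. inner (vs' k) (a (vs k)) \<ge> 0"
    using ne by eventually_elim (rule frechet_normal_sublevel(2)[OF h _ N])
  with tendsto_inner[OF vs' as] show "inner v (a x) \<ge> 0"
    by (rule tendsto_lowerbound) simp
  show "h x = 0" if "v \<noteq> 0"
  proof (rule ccontr)
    assume "h x \<noteq> 0"
    have cont: "continuous_on UNIV h"
      using h unfolding gderiv_def by (meson continuous_at_imp_continuous_on has_derivative_continuous)
    then have op: "open {u. h u < 0}"
      by (intro open_Collect_less continuous_on_const)
    have "x \<in> {u. h u < 0}" using hx \<open>h x \<noteq> 0\<close> by simp
    with vs op have "\<forall>\<^sub>F k in sequentially. vs k \<in> {u. h u < 0}"
      by (simp only: topological_tendstoD)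
    moreover have "{u. h u < 0} \<subseteq> interior {u. h u \<le> 0}"
      using op by (intro interior_maximal) auto
    ultimately have "\<forall>\<^sub>F k in sequentially. vs k \<in> interior {u. h u \<le> 0}"
      by (auto elim: eventually_mono)
    then have "\<forall>\<^sub>F k in sequentially. vs' k = 0"
      by eventually_elim (rule frechet_normal_interior[OF N])
    then have "vs' \<longlonglongrightarrow> 0" by (rule tendsto_eventually)
    with vs' that show False using LIMSEQ_unique by blast
  qed
qed

section \<open>Local inverses with a Lipschitz bound\<close>

text \<open>The inverse function theorem supplies a local homeomorphism. Its inverse is Lipschitz
  because \<open>f\<close> expands distances by at least \<open>B / 2\<close> near
  \<open>x0\<close>, where \<open>B\<close> is a lower bound for the injective derivative at
  \<open>x0\<close>.\<close>

lemma lipschitz_local_inverse: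
  fixes f :: "'a::euclidean_space \<Rightarrow> 'a" and f' :: "'a \<Rightarrow> 'a \<Rightarrow>\<^sub>L 'a"
  assumes f: "\<And>x. (f has_derivative blinfun_apply (f' x)) (at x)"
    and f': "continuous_on UNIV f'" and inj: "inj (blinfun_apply (f' x0))"
    and W: "open W" "x0 \<in> W"
  obtains U V g L where "open U" "x0 \<in> U" "U \<subseteq> W" "open V" "f x0 \<in> V"
    "\<And>y. y \<in> V \<Longrightarrow> g y \<in> U \<and> f (g y) = y"
    "\<And>x. x \<in> U \<Longrightarrow> g (f x) = x"
    "L > 0" "\<And>y y'. y \<in> V \<Longrightarrow> y' \<in> V \<Longrightarrow> norm (g y - g y') \<le> L * norm (y - y')"
proof -
  have lin: "linear (blinfun_apply (f' x0))" by (rule bounded_linear.linear) (rule blinfun.bounded_linear_right)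
  obtain B where "B > 0" and B: "\<And>x. B * norm x \<le> norm (f' x0 x)"
    using linear_inj_bounded_below_pos[OF lin inj] by blast
  have "isCont f' x0" using f' by (simp add: continuous_on_eq_continuous_at)
  then obtain r where "r > 0" and r: "\<And>x. dist x x0 < r \<Longrightarrow> norm (f' x - f' x0) < B / 2"
    using \<open>B > 0\<close> unfolding continuous_at_eps_delta dist_norm by (metis half_gt_zero)
  obtain r' where "r' > 0" and r': "ball x0 r' \<subseteq> W" using W open_contains_ball by blast
  define U0 where "U0 = ball x0 (min r r')"
  have low: "B / 2 * norm (x - y) \<le> norm (f x - f y)" if "x \<in> U0" "y \<in> U0" for x y
  proof -
    \<comment> \<open>The difference between \<open>f\<close> and its derivative at
      \<open>x0\<close> has Lipschitz constant \<open>B / 2\<close>, so it can use up at most half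
      of the lower bound \<open>B\<close>.\<close>
    have "norm ((f x - f' x0 x) - (f y - f' x0 y)) \<le> B / 2 * norm (x - y)"
    proof (rule differentiable_bound[of U0 _ "\<lambda>z. blinfun_apply (f' z - f' x0)"])
      show "((\<lambda>x. f x - f' x0 x) has_derivative blinfun_apply (f' z - f' x0)) (at z within U0)" for z
        unfolding blinfun.diff_left
        by (intro has_derivative_diff has_derivative_at_withinI[OF f] derivative_intros)
          (auto intro!: has_derivative_at_withinI bounded_linear_imp_has_derivative blinfun.bounded_linear_right)
      show "onorm (blinfun_apply (f' z - f' x0)) \<le> B / 2" if "z \<in> U0" for z
        using r[of z] that unfolding U0_def
        by (simp add: dist_commute norm_blinfun.rep_eq[symmetric] less_imp_le)
    qed (use that in \<open>auto simp: U0_def\<close>)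
    then have "norm (f' x0 (x - y)) - norm (f x - f y) \<le> B / 2 * norm (x - y)"
      using norm_triangle_ineq2[of "f' x0 (x - y)" "f x - f y"]
      by (simp add: blinfun.diff_right norm_minus_commute algebra_simps)
    with B[of "x - y"] show ?thesis by simp
  qed
  obtain k where k: "linear k" "k \<circ> blinfun_apply (f' x0) = id"
    using linear_injective_left_inverse[OF lin inj] by blast
  have left_inv: "Blinfun k o\<^sub>L f' x0 = id_blinfun"
    using k(2) by (intro blinfun_eqI)
      (simp add: bounded_linear_Blinfun_apply linear_conv_bounded_linear[symmetric] k(1) fun_eq_iff)
  have U0: "open U0" "x0 \<in> U0" using \<open>r > 0\<close> \<open>r' > 0\<close> by (auto simp: U0_def)
  obtain U V g where U: "open U" "U \<subseteq> U0" "x0 \<in> U" and V: "open V" "f x0 \<in> V"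
    and hom: "homeomorphism U V f g"
  proof (rule inverse_function_theorem[of U0 f f' x0 "Blinfun k"])
    show "continuous_on U0 f'" using continuous_on_subset[OF f' subset_UNIV] .
  qed (use U0 left_inv f that in auto)
  show thesis
  proof (rule that[of U V g "2 / B"])
    show gU: "g y \<in> U \<and> f (g y) = y" if "y \<in> V" for y
      using hom that unfolding homeomorphism_def by blast
    show "g (f x) = x" if "x \<in> U" for x using hom that unfolding homeomorphism_def by blast
    show "norm (g y - g y') \<le> 2 / B * norm (y - y')" if "y \<in> V" "y' \<in> V" for y y'
      using low[of "g y" "g y'"] gU[OF that(1)] gU[OF that(2)] U(2) \<open>B > 0\<close>
      by (auto simp: field_simps)
    show "U \<subseteq> W" using U(2) r' subset_ball[of "min r r'" r' x0] unfolding U0_def by auto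
  qed (use U V \<open>B > 0\<close> in auto)
qed

section \<open>Gradients and Hessian blocks\<close>

lemma gradient_eqI:
  assumes "GDERIV f x :> D" shows "gradient f x = D"
  unfolding gradient_def
proof (rule the_equality[where P="\<lambda>D. GDERIV f x :> D", OF assms])
  fix D' assume "GDERIV f x :> D'"
  with assms have "(\<lambda>h. inner h D) = (\<lambda>h. inner h D')"
    unfolding gderiv_def by (rule has_derivative_unique)
  then have "inner h D' = inner h D" for h by (rule fun_cong[symmetric])
  then show "D' = D" by (rule vector_eq_ldot[THEN iffD1, OF allI])
qed

text \<open>Riesz representation in coordinates, which yields an explicit formula for the
  gradient.\<close>

lemma linear_functional_eq_inner:
  fixes l :: "'a::euclidean_space \<Rightarrow> real"
  assumes "linear l"
  shows "l h = inner h (\<Sum>b\<in>Basis. l b *\<^sub>R b)"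
proof -
  interpret linear l by fact
  have "l h = l (\<Sum>b\<in>Basis. inner h b *\<^sub>R b)" by (simp add: euclidean_representation)
  also have "\<dots> = inner h (\<Sum>b\<in>Basis. l b *\<^sub>R b)"
    by (simp add: sum scale inner_sum_right mult.commute)
  finally show ?thesis .
qed

lemma GDERIV_euclidean:
  fixes f :: "'a::euclidean_space \<Rightarrow> real"
  assumes "(f has_derivative f') (at x)"
  shows "GDERIV f x :> (\<Sum>b\<in>Basis. f' b *\<^sub>R b)"
  unfolding gderiv_def
  by (rule has_derivative_eq_rhs[OF assms], rule ext,
      rule linear_functional_eq_inner[OF has_derivative_linear[OF assms]])

lemma jacobian_mult_vec:
  fixes f :: "real^'a \<Rightarrow> real^'b"
  assumes "(f has_derivative f') (at x)"
  shows "jacobian f (at x) *v h = f' h"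
proof -
  have "f differentiable at x" using assms by (rule differentiableI)
  then have "(f has_derivative (\<lambda>h. jacobian f (at x) *v h)) (at x)" by (simp add: jacobian_works)
  from has_derivative_unique[OF this assms] show ?thesis by (rule fun_cong)
qed

text \<open>Collects the calculus facts about a \<open>C2\<close> function in terms of derivatives
  in the joint variable. The \<open>x\<close>-gradient is a fixed linear map applied to
  \<open>h'\<close>, so its derivative \<open>G'\<close> comes from \<open>h''\<close>; the blocks
  of \<open>G'\<close> are the two Hessian matrices, the mixed one up to transposition.\<close>

lemma C2_partial_gradients:
  fixes h :: "(real^'n) \<times> (real^'d) \<Rightarrow> real"
  assumes "C2 h"
  obtains h' :: "(real^'n) \<times> (real^'d) \<Rightarrow> ((real^'n) \<times> (real^'d)) \<Rightarrow>\<^sub>L real"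
    and G' :: "(real^'n) \<times> (real^'d) \<Rightarrow> ((real^'n) \<times> (real^'d)) \<Rightarrow>\<^sub>L (real^'n)"
  where "\<And>z. (h has_derivative blinfun_apply (h' z)) (at z)" "continuous_on UNIV h'"
    "\<And>z. ((\<lambda>z. grad_x h (fst z) (snd z)) has_derivative blinfun_apply (G' z)) (at z)"
    "continuous_on UNIV G'"
    "\<And>x w. GDERIV (\<lambda>u. h (u, w)) x :> grad_x h x w"
    "\<And>x w u. blinfun_apply (h' (x, w)) (u, 0) = inner (grad_x h x w) u"
    "\<And>x w u. blinfun_apply (h' (x, w)) (0, u) = inner (grad_w h x w) u"
    "\<And>z u v. inner (blinfun_apply (G' z) (u, 0)) v = inner (blinfun_apply (G' z) (v, 0)) u"
    "\<And>x w u. hess_xx h x w *v u = blinfun_apply (G' (x, w)) (u, 0)"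
    "\<And>x w v u. inner (hess_wx h x w *v v) u = inner v (blinfun_apply (G' (x, w)) (0, u))"
proof -
  obtain h' :: "(real^'n) \<times> (real^'d) \<Rightarrow> ((real^'n) \<times> (real^'d)) \<Rightarrow>\<^sub>L real" and h'' where
    h': "\<And>z. (h has_derivative blinfun_apply (h' z)) (at z)" and
    h'': "\<And>z. (h' has_derivative blinfun_apply (h'' z)) (at z)" and cont: "continuous_on UNIV h''"
    using assms unfolding C2_def by blast
  have dx: "((\<lambda>u. h (u, w)) has_derivative (\<lambda>u. h' (x, w) (u, 0))) (at x)" for x w
    by (rule has_derivative_compose[OF _ h']) (auto intro!: derivative_eq_intros)
  have dw: "((\<lambda>u. h (x, u)) has_derivative (\<lambda>u. h' (x, w) (0, u))) (at w)" for x w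
    by (rule has_derivative_compose[OF _ h']) (auto intro!: derivative_eq_intros)
  have gx: "GDERIV (\<lambda>u. h (u, w)) x :> grad_x h x w" for x w
    using GDERIV_euclidean[OF dx[of w x]]
    unfolding grad_x_def gradient_eqI[OF GDERIV_euclidean[OF dx[of w x]]] .
  have gw: "GDERIV (\<lambda>u. h (x, u)) w :> grad_w h x w" for x w
    using GDERIV_euclidean[OF dw[of x w]]
    unfolding grad_w_def gradient_eqI[OF GDERIV_euclidean[OF dw[of x w]]] .
  have hx: "h' (x, w) (u, 0) = inner (grad_x h x w) u" for x w u
    using fun_cong[OF has_derivative_unique[OF dx[of w x] gx[unfolded gderiv_def]], of u]
    by (simp add: inner_commute)
  have hw: "h' (x, w) (0, u) = inner (grad_w h x w) u" for x w u
    using fun_cong[OF has_derivative_unique[OF dw[of x w] gw[unfolded gderiv_def]], of u]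
    by (simp add: inner_commute)
  \<comment> \<open>\<open>T p\<close> is the vector that represents the restriction of the
    functional \<open>p\<close> to directions \<open>(u, 0)\<close>.\<close>
  define T :: "(((real^'n) \<times> (real^'d)) \<Rightarrow>\<^sub>L real) \<Rightarrow> real^'n"
    where "T p = (\<Sum>b\<in>Basis. p (b, 0) *\<^sub>R b)" for p
  have T: "bounded_linear T" unfolding T_def
    by (intro bounded_linear_sum bounded_linear_compose[OF bounded_linear_scaleR_left]
        blinfun.bounded_linear_left)
  have T_inner: "inner (T p) u = p (u, 0)" for p u
  proof -
    have "linear (\<lambda>u. p (u, 0))"
      using blinfun.add_right[of p "(_, 0)" "(_, 0)"] blinfun.scaleR_right[of p _ "(_, 0)"]
      by (intro linearI) simp_all
    from linear_functional_eq_inner[OF this, of u] show ?thesis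
      unfolding T_def by (simp add: inner_commute)
  qed
  have T_grad: "T (h' z) = grad_x h (fst z) (snd z)" for z
  proof -
    have "inner (T (h' z)) u = inner (grad_x h (fst z) (snd z)) u" for u
      using T_inner[of "h' z" u] hx[of "fst z" "snd z" u] by simp
    then show ?thesis by (rule vector_eq_rdot[THEN iffD1, OF allI])
  qed
  define G' where "G' z = Blinfun T o\<^sub>L h'' z" for z
  have G'_app: "G' z u = T (h'' z u)" for z u
    unfolding G'_def by (simp add: bounded_linear_Blinfun_apply T)
  have G: "((\<lambda>z. grad_x h (fst z) (snd z)) has_derivative blinfun_apply (G' z)) (at z)" for z
  proof -
    have "blinfun_apply (G' z) = (\<lambda>u. T (h'' z u))" by (rule ext) (rule G'_app)
    then show ?thesis using bounded_linear.has_derivative[OF T h'', of z] by (simp only: T_grad)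
  qed
  show thesis
  proof (rule that[OF h' _ G _ gx hx hw])
    show "continuous_on UNIV h'"
      by (intro continuous_at_imp_continuous_on ballI has_derivative_continuous[OF h''])
    show "continuous_on UNIV G'" unfolding G'_def
      by (intro continuous_intros cont)
    \<comment> \<open>By \<open>T_inner\<close> the two sides are \<open>h'' z\<close> at
      \<open>(u, 0)\<close> and \<open>(v, 0)\<close>, in opposite orders.\<close>
    show "inner (G' z (u, 0)) v = inner (G' z (v, 0)) u" for z u v
      unfolding G'_app T_inner by (rule second_derivative_symmetric[OF h' h''])
    show "hess_xx h x w *v u = G' (x, w) (u, 0)" for x w u
      unfolding hess_xx_def
    proof (rule jacobian_mult_vec)
      show "((\<lambda>u. grad_x h u w) has_derivative (\<lambda>u. G' (x, w) (u, 0))) (at x)"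
      proof -
        have "((\<lambda>u. (u, w)) has_derivative (\<lambda>u. (u, 0))) (at x)"
          by (auto intro!: derivative_eq_intros)
        from has_derivative_compose[OF this G] show ?thesis by simp
      qed
    qed
    have "jacobian (\<lambda>u. grad_x h x u) (at w) *v u = G' (x, w) (0, u)" for x w u
    proof (rule jacobian_mult_vec)
      show "((\<lambda>u. grad_x h x u) has_derivative (\<lambda>u. G' (x, w) (0, u))) (at w)"
      proof -
        have "((\<lambda>u. (x, u)) has_derivative (\<lambda>u. (0, u))) (at w)"
          by (auto intro!: derivative_eq_intros)
        from has_derivative_compose[OF this G] show ?thesis by simp
      qed
    qed
    then show "inner (hess_wx h x w *v v) u = inner v (G' (x, w) (0, u))" for x w v u
      unfolding hess_wx_def by (simp add: transpose_matrix_vector dot_lmul_matrix)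
  qed
qed

lemma differentiable_grad_x:
  assumes "C2 h"
  shows "(\<lambda>z. grad_x h (fst z) (snd z)) differentiable (at z)"
  by (rule C2_partial_gradients[OF assms]) (rule differentiableI)

lemma GDERIV_grad_x:
  assumes "C2 h"
  shows "GDERIV (\<lambda>u. h (u, w)) x :> grad_x h x w"
  by (rule C2_partial_gradients[OF assms])

lemma isCont_grad_x:
  assumes "C2 h"
  shows "isCont (\<lambda>u. grad_x h u w) x"
  using isCont_o2[OF _ differentiable_imp_continuous_within[OF differentiable_grad_x[OF assms]],
      of x "\<lambda>u. (u, w)"] by simp

section \<open>Stationarity expressed through multipliers\<close>

lemma stationary_pointI:
  assumes "C2 F" "F (x, w) = 0" "l \<ge> 0" "grad_x f0 x w + l *\<^sub>R grad_x F x w = 0"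
  shows "x \<in> stationary_points f0 F w"
proof -
  have "l *\<^sub>R grad_x F x w \<in> limiting_normal_cone (feasible_set F w) x"
    unfolding feasible_set_def
    using multiplier_in_frechet_normal_cone[OF GDERIV_grad_x[OF assms(1)] assms(2,3)]
      frechet_subset_limiting by blast
  then show ?thesis
    unfolding stationary_points_def using assms(4) by (auto intro: rev_image_eqI)
qed

text \<open>The normal vector in the stationarity condition is \<open>- grad_x f0 x w\<close>. As a
  limiting normal it equals its projection onto the line of \<open>grad_x F x w\<close>, and if it
  is nonzero the constraint is active.\<close>

lemma stationary_pointD:
  assumes "C2 F" "x \<in> stationary_points f0 F w" "grad_x F x w \<noteq> 0"
  shows "grad_x f0 x w - (inner (grad_x f0 x w) (grad_x F x w) /
           inner (grad_x F x w) (grad_x F x w)) *\<^sub>R grad_x F x w = 0"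
    and "grad_x f0 x w \<noteq> 0 \<Longrightarrow> F (x, w) = 0"
proof -
  obtain v where v: "grad_x f0 x w + v = 0"
    and N: "v \<in> limiting_normal_cone {u. F (u, w) \<le> 0} x"
    using assms(2) unfolding stationary_points_def feasible_set_def by auto
  have "v = - grad_x f0 x w" using v by (simp add: eq_neg_iff_add_eq_0 add.commute)
  then show "grad_x f0 x w - (inner (grad_x f0 x w) (grad_x F x w) /
           inner (grad_x F x w) (grad_x F x w)) *\<^sub>R grad_x F x w = 0"
    "grad_x f0 x w \<noteq> 0 \<Longrightarrow> F (x, w) = 0"
    using limiting_normal_sublevel[OF GDERIV_grad_x[OF assms(1)] isCont_grad_x[OF assms(1)] assms(3) N]
    by (simp_all add: algebra_simps)
qed

text \<open>An explicit quotient of inner products serves as \<open>m\<close>. It is differentiable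
  where \<open>grad_x F\<close> is nonzero and gives the multiplier at every stationary point near
  the base point, so the multiplier need not be treated as an unknown there.\<close>

lemma stationary_multiplier_function:
  fixes f0 F :: "(real^'n) \<times> (real^'d) \<Rightarrow> real"
  assumes "C2 f0" "C2 F" "grad_x F xbar wbar \<noteq> 0"
    and "lagrange_multiplier f0 F xbar wbar lam" "lam > 0"
  obtains m where "m differentiable (at (xbar, wbar))" "m (xbar, wbar) = lam"
    "\<forall>\<^sub>F z in nhds (xbar, wbar). fst z \<in> stationary_points f0 F (snd z) \<longrightarrow>
       F z = 0 \<and> grad_x f0 (fst z) (snd z) + m z *\<^sub>R grad_x F (fst z) (snd z) = 0"
proof -
  let ?a = "\<lambda>z. grad_x f0 (fst z) (snd z)" and ?b = "\<lambda>z. grad_x F (fst z) (snd z)"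
  define m where "m z = - (inner (?a z) (?b z) / inner (?b z) (?b z))" for z
  have lag: "grad_x f0 xbar wbar = - lam *\<^sub>R grad_x F xbar wbar"
    using assms(4) unfolding lagrange_multiplier_def by (simp add: eq_neg_iff_add_eq_0)
  note d = differentiable_grad_x[OF assms(1)] differentiable_grad_x[OF assms(2)]
  have ev_ne: "\<forall>\<^sub>F z in nhds (xbar, wbar). grad_x h (fst z) (snd z) \<noteq> 0"
    if "C2 h" "grad_x h xbar wbar \<noteq> 0" for h :: "(real^'n) \<times> (real^'d) \<Rightarrow> real"
  proof -
    have "filterlim (\<lambda>z. grad_x h (fst z) (snd z)) (nhds (grad_x h xbar wbar)) (nhds (xbar, wbar))"
      using differentiable_imp_continuous_within[OF differentiable_grad_x[OF that(1), of "(xbar, wbar)"]]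
      unfolding continuous_within
      using tendsto_at_iff_tendsto_nhds[of "\<lambda>z. grad_x h (fst z) (snd z)" "(xbar, wbar)"] by simp
    then show ?thesis using that(2) by (rule tendsto_imp_eventually_ne)
  qed
  show thesis
  proof (rule that[of m])
    show "m differentiable (at (xbar, wbar))"
      unfolding m_def using assms(3)
      by (intro differentiable_minus differentiable_divide differentiable_inner d) auto
    show "m (xbar, wbar) = lam" unfolding m_def using assms(3) lag by simp
    \<comment> \<open>Positivity of \<open>lam\<close> enters here: \<open>grad_x f0\<close> is
      nonzero at the base point, hence nearby, and this forces \<open>F z = 0\<close> at stationary
      points.\<close>
    have "grad_x f0 xbar wbar \<noteq> 0" using lag assms(3,5) by simp
    from ev_ne[OF assms(1) this] ev_ne[OF assms(2,3)]
    show "\<forall>\<^sub>F z in nhds (xbar, wbar). fst z \<in> stationary_points f0 F (snd z) \<longrightarrow>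
       F z = 0 \<and> ?a z + m z *\<^sub>R ?b z = 0"
    proof eventually_elim
      case (elim z)
      show ?case
        using stationary_pointD[OF assms(2) _ elim(2)] elim(1) unfolding m_def by auto
    qed
  qed
qed

section \<open>Necessary and sufficient criteria for the Lipschitz-like property\<close>

text \<open>Moving the parameter by \<open>t *\<^sub>R q\<close> can be matched by a point of the
  graph at distance at most \<open>t * K\<close>. There \<open>\<phi>\<close> vanishes, while its
  linear part is \<open>t * inner q q\<close>, so \<open>inner q q\<close> is smaller than any
  positive number.\<close>

lemma lipschitz_like_normal_eq_0:
  fixes S :: "'w::real_inner \<Rightarrow> 'x::real_inner set"
  assumes lip: "lipschitz_like_around S wbar xbar" and "xbar \<in> S wbar"
    and \<phi>: "(\<phi> has_derivative (\<lambda>h. inner q (snd h))) (at (xbar, wbar))"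
    and zero: "\<forall>\<^sub>F z in nhds (xbar, wbar). fst z \<in> S (snd z) \<longrightarrow> \<phi> z = 0"
  shows "q = 0"
proof -
  obtain l U V where "l > 0" "open U" "xbar \<in> U" "open V" "wbar \<in> V"
    and *: "\<forall>w\<in>V. \<forall>w'\<in>V.
      S w' \<inter> U \<subseteq> {x + (l * norm (w' - w)) *\<^sub>R b | x b. x \<in> S w \<and> b \<in> cball 0 1}"
    using lip unfolding lipschitz_like_around_def by (elim exE conjE)
  \<comment> \<open>The summands bound the displacement of \<open>x\<close>, by
    \<open>l * t * norm q\<close>, and that of \<open>w\<close>, by
    \<open>t * norm q\<close>.\<close>
  define K where "K = (l + 1) * norm q"
  have "K \<ge> 0" using \<open>l > 0\<close> by (simp add: K_def)
  obtain r where "r > 0" and r: "\<And>z. dist z (xbar, wbar) < r \<Longrightarrow> fst z \<in> S (snd z) \<Longrightarrow> \<phi> z = 0"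
    using zero unfolding eventually_nhds_metric by blast
  have \<phi>0: "\<phi> (xbar, wbar) = 0" using r[of "(xbar, wbar)"] \<open>r > 0\<close> \<open>xbar \<in> S wbar\<close> by simp
  have near: "\<exists>x\<in>S (wbar + t *\<^sub>R q). norm ((x, wbar + t *\<^sub>R q) - (xbar, wbar)) \<le> t * K"
    if "t > 0" and wt: "wbar + t *\<^sub>R q \<in> V" for t
  proof -
    let ?w = "wbar + t *\<^sub>R q"
    obtain x b where x: "x \<in> S ?w" and b: "norm b \<le> 1"
      and xb: "xbar = x + (l * norm (wbar - ?w)) *\<^sub>R b"
      \<comment> \<open>The inclusion is applied to \<open>xbar\<close> as a point over
        \<open>wbar\<close>, with \<open>?w\<close> as the target parameter.\<close>
      using bspec[OF bspec[OF * wt] \<open>wbar \<in> V\<close>] \<open>xbar \<in> S wbar\<close> \<open>xbar \<in> U\<close> by auto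
    have "norm (x - xbar) = l * (t * norm q) * norm b"
      unfolding xb using \<open>t > 0\<close> \<open>l > 0\<close> by (simp add: xb[symmetric])
    also have "\<dots> \<le> l * (t * norm q)" using b \<open>t > 0\<close> \<open>l > 0\<close> by (intro mult_left_le) auto
    finally have "norm ((x, ?w) - (xbar, wbar)) \<le> l * (t * norm q) + t * norm q"
      using norm_Pair_le[of "x - xbar" "t *\<^sub>R q"] \<open>t > 0\<close> by simp
    with x show ?thesis unfolding K_def by (auto simp: algebra_simps)
  qed
  have "inner q q \<le> 0 + e" if "e > 0" for e
  proof -
    \<comment> \<open>\<open>K\<close> is zero when \<open>q = 0\<close>; the summand 1 keeps the
      divisor positive.\<close>
    have "e / (K + 1) > 0" using that \<open>K \<ge> 0\<close> by simp
    then obtain d where "d > 0" and d: "\<And>z. norm (z - (xbar, wbar)) < d \<Longrightarrow>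
        norm (\<phi> z - \<phi> (xbar, wbar) - inner q (snd (z - (xbar, wbar)))) \<le> e / (K + 1) * norm (z - (xbar, wbar))"
      using \<phi> unfolding has_derivative_at_alt by blast
    have "\<forall>\<^sub>F t in at_right 0. wbar + t *\<^sub>R q \<in> V"
      by (rule topological_tendstoD[OF _ \<open>open V\<close> \<open>wbar \<in> V\<close>]) (auto intro!: tendsto_eq_intros)
    moreover have "\<forall>\<^sub>F t in at_right 0. t * K < min r d"
    proof (rule order_tendstoD(2))
      show "((\<lambda>t. t * K) \<longlongrightarrow> 0) (at_right 0)" by (auto intro!: tendsto_eq_intros)
    qed (use \<open>r > 0\<close> \<open>d > 0\<close> in simp)
    moreover have "\<forall>\<^sub>F t in at_right (0::real). t > 0" by (rule eventually_at_right_less)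
    ultimately have "\<forall>\<^sub>F t in at_right (0::real). t > 0 \<and> wbar + t *\<^sub>R q \<in> V \<and> t * K < min r d"
      by eventually_elim simp
    then obtain t where t: "t > 0" "wbar + t *\<^sub>R q \<in> V" "t * K < min r d"
      using eventually_happens' trivial_limit_at_right_real by blast
    from near[OF t(1,2)] obtain x where x: "x \<in> S (wbar + t *\<^sub>R q)"
      and n: "norm ((x, wbar + t *\<^sub>R q) - (xbar, wbar)) \<le> t * K" by blast
    have "\<phi> (x, wbar + t *\<^sub>R q) = 0" using r[of "(x, wbar + t *\<^sub>R q)"] x n t(3) by (simp add: dist_norm)
    then have "t * inner q q \<le> e / (K + 1) * norm ((x, wbar + t *\<^sub>R q) - (xbar, wbar))"
      using d[of "(x, wbar + t *\<^sub>R q)"] n t(3) \<phi>0 by simp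
    also have "\<dots> \<le> e / (K + 1) * (t * K)"
      using n \<open>e / (K + 1) > 0\<close> by (intro mult_left_mono) auto
    also have "\<dots> = t * (e * (K / (K + 1)))" by simp
    finally have "inner q q \<le> e * (K / (K + 1))"
      using t(1) by (simp only: mult_le_cancel_left_pos)
    also have "\<dots> \<le> e" using \<open>e > 0\<close> \<open>K \<ge> 0\<close> by (intro mult_left_le) auto
    finally show ?thesis by simp
  qed
  then have "inner q q \<le> 0" by (rule field_le_epsilon)
  then show ?thesis by (metis inner_gt_zero_iff not_le)
qed

text \<open>Inside \<open>U\<close> the set \<open>S w'\<close> contains at most the point
  \<open>x w'\<close>, and \<open>x w\<close> is a point of \<open>S w\<close> within the required
  distance of it.\<close>

lemma lipschitz_like_aroundI:
  assumes W: "open W" "wbar \<in> W" and U: "open U" "xbar \<in> U" and "L > 0"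
    and x: "\<And>w. w \<in> W \<Longrightarrow> x w \<in> S w"
    and unique: "\<And>w u. w \<in> W \<Longrightarrow> u \<in> S w \<inter> U \<Longrightarrow> u = x w"
    and lip: "\<And>w w'. w \<in> W \<Longrightarrow> w' \<in> W \<Longrightarrow> norm (x w' - x w) \<le> L * norm (w' - w)"
  shows "lipschitz_like_around S wbar xbar"
  unfolding lipschitz_like_around_def
proof (intro exI[of _ L] conjI exI[of _ U] exI[of _ W] ballI subsetI)
  fix w w' u assume w: "w \<in> W" and w': "w' \<in> W" and "u \<in> S w' \<inter> U"
  then have u: "u = x w'" using unique by blast
  let ?c = "L * norm (w' - w)"
  \<comment> \<open>If \<open>?c = 0\<close>, inversion of zero gives \<open>b = 0\<close>, which is
    still correct because the displacement vanishes too.\<close>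
  define b where "b = (x w' - x w) /\<^sub>R ?c"
  have "?c *\<^sub>R b = x w' - x w"
  proof (cases "?c = 0")
    case True
    then show ?thesis using lip[OF w w'] by (auto simp only: norm_le_zero_iff scaleR_zero_left)
  next
    case False
    then show ?thesis unfolding b_def by (simp only: scaleR_scaleR right_inverse[OF False] scaleR_one)
  qed
  then have "u = x w + ?c *\<^sub>R b" using u by simp
  moreover have "norm b \<le> 1"
  proof -
    have "?c \<ge> 0" using \<open>L > 0\<close> by simp
    then have "norm b = norm (x w' - x w) / ?c"
      unfolding b_def by (simp only: norm_scaleR abs_inverse abs_of_nonneg divide_inverse_commute)
    also have "\<dots> \<le> 1" using lip[OF w w'] \<open>?c \<ge> 0\<close> by (intro divide_le_eq_1[THEN iffD2]) linarith
    finally show ?thesis .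
  qed
  ultimately show "u \<in> {x + ?c *\<^sub>R b | x b. x \<in> S w \<and> b \<in> cball 0 1}"
    using x[OF w] by auto
qed (use assms in auto)

section \<open>The two implications\<close>

text \<open>The pair \<open>(v, c)\<close> serves as coefficients for the equations valid on the
  graph. The resulting scalar function \<open>\<phi>\<close> varies to first order only in
  \<open>w\<close>, and its gradient there is the vector to be shown zero.\<close>

lemma lipschitz_like_imp_kernel_subset:
  fixes f0 F :: "(real^'n) \<times> (real^'d) \<Rightarrow> real"
    and xbar :: "real^'n" and wbar :: "real^'d" and lam :: real
  defines "H \<equiv> hess_xx f0 xbar wbar + lam *\<^sub>R hess_xx F xbar wbar"
    and "B \<equiv> hess_wx f0 xbar wbar + lam *\<^sub>R hess_wx F xbar wbar"
  assumes C2: "C2 f0" "C2 F" and stat: "xbar \<in> stationary_points f0 F wbar"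
    and g: "grad_x F xbar wbar \<noteq> 0"
    and lag: "lagrange_multiplier f0 F xbar wbar lam" and "lam > 0"
    and lip: "lipschitz_like_around (stationary_points f0 F) wbar xbar"
    and A1: "H *v v + c *\<^sub>R grad_x F xbar wbar = 0"
    and gv: "inner (grad_x F xbar wbar) v = 0"
  shows "B *v v + c *\<^sub>R grad_w F xbar wbar = 0"
proof -
  obtain G0 where G0: "\<And>z. ((\<lambda>z. grad_x f0 (fst z) (snd z)) has_derivative blinfun_apply (G0 z)) (at z)"
    and sym0: "\<And>z u v. inner (blinfun_apply (G0 z) (u, 0)) v = inner (blinfun_apply (G0 z) (v, 0)) u"
    and xx0: "\<And>x w u. hess_xx f0 x w *v u = blinfun_apply (G0 (x, w)) (u, 0)"
    and wx0: "\<And>x w v u. inner (hess_wx f0 x w *v v) u = inner v (blinfun_apply (G0 (x, w)) (0, u))"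
    by (rule C2_partial_gradients[OF C2(1)]) (rule that)
  obtain F' G where F': "\<And>z. (F has_derivative blinfun_apply (F' z)) (at z)"
    and G: "\<And>z. ((\<lambda>z. grad_x F (fst z) (snd z)) has_derivative blinfun_apply (G z)) (at z)"
    and Fx: "\<And>x w u. blinfun_apply (F' (x, w)) (u, 0) = inner (grad_x F x w) u"
    and Fw: "\<And>x w u. blinfun_apply (F' (x, w)) (0, u) = inner (grad_w F x w) u"
    and sym: "\<And>z u v. inner (blinfun_apply (G z) (u, 0)) v = inner (blinfun_apply (G z) (v, 0)) u"
    and xx: "\<And>x w u. hess_xx F x w *v u = blinfun_apply (G (x, w)) (u, 0)"
    and wx: "\<And>x w v u. inner (hess_wx F x w *v v) u = inner v (blinfun_apply (G (x, w)) (0, u))"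
    by (rule C2_partial_gradients[OF C2(2)]) (rule that)
  obtain m where "m differentiable (at (xbar, wbar))" and mbar: "m (xbar, wbar) = lam"
    and m: "\<forall>\<^sub>F z in nhds (xbar, wbar). fst z \<in> stationary_points f0 F (snd z) \<longrightarrow>
       F z = 0 \<and> grad_x f0 (fst z) (snd z) + m z *\<^sub>R grad_x F (fst z) (snd z) = 0"
    using stationary_multiplier_function[OF C2 g lag \<open>lam > 0\<close>] .
  then obtain m' where m': "(m has_derivative m') (at (xbar, wbar))"
    unfolding differentiable_def by blast
  define q where "q = B *v v + c *\<^sub>R grad_w F xbar wbar"
  define \<phi> where "\<phi> z = inner (grad_x f0 (fst z) (snd z) + m z *\<^sub>R grad_x F (fst z) (snd z)) v + c * F z" for z
  have split: "blinfun_apply P (u, w) = P (u, 0) + P (0, w)" for P :: "((real^'n) \<times> (real^'d)) \<Rightarrow>\<^sub>L 'c::real_normed_vector" and u w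
    using blinfun.add_right[of P "(u, 0)" "(0, w)"] by simp
  have "q = 0"
  proof (rule lipschitz_like_normal_eq_0[OF lip stat])
    show "\<forall>\<^sub>F z in nhds (xbar, wbar). fst z \<in> stationary_points f0 F (snd z) \<longrightarrow> \<phi> z = 0"
      using m by eventually_elim (auto simp: \<phi>_def)
    let ?z = "(xbar, wbar)"
    \<comment> \<open>The product rule leaves a term with \<open>m'\<close>, but it is a multiple of
      \<open>grad_x F xbar wbar\<close> and disappears after pairing with \<open>v\<close>, by
      \<open>gv\<close>.\<close>
    have "(\<phi> has_derivative (\<lambda>h. inner (G0 ?z h + (lam *\<^sub>R G ?z h + m' h *\<^sub>R grad_x F xbar wbar)) v + c * F' ?z h)) (at ?z)"
      unfolding \<phi>_def
      by (auto intro!: derivative_eq_intros G0 G m' F' simp: mbar)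
    then show "(\<phi> has_derivative (\<lambda>h. inner q (snd h))) (at ?z)"
    proof (rule has_derivative_eq_rhs, intro ext)
      fix h :: "(real^'n) \<times> (real^'d)"
      obtain u w where h: "h = (u, w)" by fastforce
      \<comment> \<open>Symmetry of the \<open>x\<close>-blocks exchanges \<open>u\<close> and
        \<open>v\<close>, so that the left-hand side of \<open>A1\<close> appears, paired with
        \<open>u\<close>.\<close>
      have "inner (G0 ?z (u, 0) + lam *\<^sub>R G ?z (u, 0)) v + c * F' ?z (u, 0) =
          inner (H *v v + c *\<^sub>R grad_x F xbar wbar) u"
        using sym0[of ?z u v] sym[of ?z u v]
        by (simp add: H_def matrix_vector_mult_add_rdistrib scaleR_matrix_vector_assoc[symmetric]
            xx0 xx Fx inner_add_left)
      then have 1: "inner (G0 ?z (u, 0) + lam *\<^sub>R G ?z (u, 0)) v + c * F' ?z (u, 0) = 0"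
        using A1 by simp
      have 2: "inner (G0 ?z (0, w) + lam *\<^sub>R G ?z (0, w)) v + c * F' ?z (0, w) = inner q w"
        by (simp add: q_def B_def matrix_vector_mult_add_rdistrib scaleR_matrix_vector_assoc[symmetric]
            wx0 wx Fw inner_add_left inner_commute[of v])
      show "inner (G0 ?z h + (lam *\<^sub>R G ?z h + m' h *\<^sub>R grad_x F xbar wbar)) v + c * F' ?z h
          = inner q (snd h)"
        using 1 2 gv split[of "G0 ?z" u w] split[of "G ?z" u w] split[of "F' ?z" u w]
        by (simp add: h inner_add_left algebra_simps)
    qed
  qed
  then show ?thesis unfolding q_def .
qed

text \<open>The optimality system in point and multiplier has an injective derivative at the base
  point. Its local inverse yields a Lipschitz selection of stationary points, and continuity of
  \<open>m\<close> shows that no other stationary points lie near \<open>xbar\<close>.\<close>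

lemma trivial_kernel_imp_lipschitz_like:
  fixes f0 F :: "(real^'n) \<times> (real^'d) \<Rightarrow> real"
    and xbar :: "real^'n" and wbar :: "real^'d" and lam :: real
  defines "H \<equiv> hess_xx f0 xbar wbar + lam *\<^sub>R hess_xx F xbar wbar"
  assumes C2: "C2 f0" "C2 F"
    and F0: "F (xbar, wbar) = 0" and g: "grad_x F xbar wbar \<noteq> 0"
    and lag: "lagrange_multiplier f0 F xbar wbar lam" and "lam > 0"
    and ker: "\<And>v c. H *v v + c *\<^sub>R grad_x F xbar wbar = 0 \<Longrightarrow>
      inner (grad_x F xbar wbar) v = 0 \<Longrightarrow> v = 0 \<and> c = 0"
  shows "lipschitz_like_around (stationary_points f0 F) wbar xbar"
proof -
  let ?a = "\<lambda>z. grad_x f0 (fst z) (snd z)" and ?b = "\<lambda>z. grad_x F (fst z) (snd z)"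
  obtain G0 where G0: "\<And>z. (?a has_derivative blinfun_apply (G0 z)) (at z)"
    and cG0: "continuous_on UNIV G0"
    and xx0: "\<And>x w u. hess_xx f0 x w *v u = blinfun_apply (G0 (x, w)) (u, 0)"
    by (rule C2_partial_gradients[OF C2(1)]) (rule that)
  obtain F' G where F': "\<And>z. (F has_derivative blinfun_apply (F' z)) (at z)"
    and cF': "continuous_on UNIV F'"
    and G: "\<And>z. (?b has_derivative blinfun_apply (G z)) (at z)"
    and cG: "continuous_on UNIV G"
    and Fx: "\<And>x w u. blinfun_apply (F' (x, w)) (u, 0) = inner (grad_x F x w) u"
    and xx: "\<And>x w u. hess_xx F x w *v u = blinfun_apply (G (x, w)) (u, 0)"
    by (rule C2_partial_gradients[OF C2(2)]) (rule that)
  obtain m where "m differentiable (at (xbar, wbar))" and mbar: "m (xbar, wbar) = lam"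
    and m: "\<forall>\<^sub>F z in nhds (xbar, wbar). fst z \<in> stationary_points f0 F (snd z) \<longrightarrow>
       F z = 0 \<and> ?a z + m z *\<^sub>R ?b z = 0"
    using stationary_multiplier_function[OF C2 g lag \<open>lam > 0\<close>] .
  then have cm: "isCont m (xbar, wbar)" by (simp add: differentiable_imp_continuous_within)
  \<comment> \<open>The parameter is repeated in the output, so domain and range agree and the
    inverse function theorem applies without an implicit-function version.\<close>
  define \<Psi> where "\<Psi> y = ((?a (fst y) + snd y *\<^sub>R ?b (fst y), snd (fst y)), F (fst y))"
    for y :: "((real^'n) \<times> (real^'d)) \<times> real"
  define D where "D y h = ((G0 (fst y) (fst h) + (snd y *\<^sub>R G (fst y) (fst h) + snd h *\<^sub>R ?b (fst y)),
      snd (fst h)), F' (fst y) (fst h))"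
    for y h :: "((real^'n) \<times> (real^'d)) \<times> real"
  have D: "(\<Psi> has_derivative D y) (at y)" for y
    unfolding \<Psi>_def D_def[abs_def]
    by (intro has_derivative_Pair has_derivative_add has_derivative_scaleR
        has_derivative_compose[OF _ G0] has_derivative_compose[OF _ G] has_derivative_compose[OF _ F']
        has_derivative_fst has_derivative_snd has_derivative_ident)
  have D_app: "blinfun_apply (Blinfun (D y)) = D y" for y
    by (rule bounded_linear_Blinfun_apply[OF has_derivative_bounded_linear[OF D]])
  have cD: "continuous_on UNIV (\<lambda>y. Blinfun (D y))"
  \<comment> \<open>In finite dimension, continuity in the operator norm can be tested on basis
    vectors.\<close>
  proof (rule continuous_on_blinfun_componentwise)
    have cg: "continuous_on UNIV ?b"
      using G by (meson continuous_at_imp_continuous_on has_derivative_continuous)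
    show "continuous_on UNIV (\<lambda>y. Blinfun (D y) i)" for i
      unfolding D_app unfolding D_def
      by (intro continuous_intros continuous_on_compose2[OF cG0] continuous_on_compose2[OF cG]
          continuous_on_compose2[OF cF'] continuous_on_compose2[OF cg]) auto
  qed
  let ?p = "((xbar, wbar), lam)"
  have lag0: "grad_x f0 xbar wbar + lam *\<^sub>R grad_x F xbar wbar = 0"
    using lag by (simp add: lagrange_multiplier_def)
  then have \<Psi>0: "\<Psi> ?p = ((0, wbar), 0)" unfolding \<Psi>_def using F0 by simp
  have lin: "linear (D ?p)" using D by (rule has_derivative_linear)
  have inj: "inj (blinfun_apply (Blinfun (D ?p)))"
    unfolding D_app linear_injective_0[OF lin]
  proof (intro allI impI)
    fix h assume h: "D ?p h = 0"
    obtain u w c where huwc: "h = ((u, w), c)" by (metis surj_pair)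
    \<comment> \<open>The repeated parameter forces \<open>w = 0\<close>; what remains of the
      linearised system is exactly the premise of \<open>ker\<close>.\<close>
    have "w = 0" using h unfolding huwc D_def by (simp add: zero_prod_def)
    then have "u = 0 \<and> c = 0"
      using h unfolding huwc D_def
      by (intro ker) (simp_all add: zero_prod_def H_def matrix_vector_mult_add_rdistrib
          scaleR_matrix_vector_assoc[symmetric] xx0 xx Fx add.assoc)
    with \<open>w = 0\<close> show "h = 0" by (simp add: huwc zero_prod_def)
  qed
  \<comment> \<open>Restricting to positive multipliers ensures that solutions produced by the local
    inverse satisfy the sign condition and are stationary.\<close>
  have openW: "open (UNIV \<times> {0<..} :: (((real^'n) \<times> (real^'d)) \<times> real) set)"
    by (intro open_Times) auto
  obtain U V \<gamma> L where U: "open U" "?p \<in> U" "U \<subseteq> UNIV \<times> {0<..}" and V: "open V" "\<Psi> ?p \<in> V"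
    and \<gamma>: "\<And>y. y \<in> V \<Longrightarrow> \<gamma> y \<in> U \<and> \<Psi> (\<gamma> y) = y" and \<gamma>': "\<And>y. y \<in> U \<Longrightarrow> \<gamma> (\<Psi> y) = y"
    and "L > 0" and L: "\<And>y y'. y \<in> V \<Longrightarrow> y' \<in> V \<Longrightarrow> norm (\<gamma> y - \<gamma> y') \<le> L * norm (y - y')"
    by (rule lipschitz_local_inverse[of \<Psi> "\<lambda>y. Blinfun (D y)" ?p, OF _ cD inj openW])
      (use D D_app \<open>lam > 0\<close> in auto)
  \<comment> \<open>\<open>\<iota> w\<close> is the right-hand side with zero residuals and
    parameter \<open>w\<close>.\<close>
  define \<iota> :: "real^'d \<Rightarrow> ((real^'n) \<times> (real^'d)) \<times> real" where "\<iota> w = ((0, w), 0)" for w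
  define x where "x w = fst (fst (\<gamma> (\<iota> w)))" for w
  \<comment> \<open>The local inverse recognises only solutions in \<open>U\<close>; continuity of
    \<open>m\<close> puts the multipliers of nearby stationary points in range.\<close>
  have "\<forall>\<^sub>F z in nhds (xbar, wbar). (z, m z) \<in> U"
  proof (rule topological_tendstoD[OF _ U(1,2)])
    have "(m \<longlongrightarrow> lam) (nhds (xbar, wbar))"
      using cm mbar tendsto_at_iff_tendsto_nhds[of m "(xbar, wbar)"] by (simp add: isCont_def)
    then show "((\<lambda>z. (z, m z)) \<longlongrightarrow> ?p) (nhds (xbar, wbar))"
      by (intro tendsto_Pair) (simp_all add: filterlim_ident)
  qed
  with m have "\<forall>\<^sub>F z in nhds (xbar, wbar). fst z \<in> stationary_points f0 F (snd z) \<longrightarrow>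
      F z = 0 \<and> ?a z + m z *\<^sub>R ?b z = 0 \<and> (z, m z) \<in> U"
    by eventually_elim blast
  then obtain N where "open N" "(xbar, wbar) \<in> N"
    and N: "\<And>z. z \<in> N \<Longrightarrow> fst z \<in> stationary_points f0 F (snd z) \<Longrightarrow>
      F z = 0 \<and> ?a z + m z *\<^sub>R ?b z = 0 \<and> (z, m z) \<in> U"
    unfolding eventually_nhds by blast
  then obtain X W where X: "open X" "xbar \<in> X" and W: "open W" "wbar \<in> W" and XW: "X \<times> W \<subseteq> N"
    by (elim open_prod_elim) auto
  show ?thesis
  proof (rule lipschitz_like_aroundI[of "W \<inter> \<iota> -` V" wbar X xbar L x])
    show "open (W \<inter> \<iota> -` V)"
      unfolding \<iota>_def by (intro open_Int W(1) open_vimage V(1) continuous_intros)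
    show "wbar \<in> W \<inter> \<iota> -` V" using W(2) V(2) \<Psi>0 by (simp add: \<iota>_def)
    show "x w \<in> stationary_points f0 F w" if "w \<in> W \<inter> \<iota> -` V" for w
    proof -
      obtain u w' l where *: "\<gamma> (\<iota> w) = ((u, w'), l)" by (metis surj_pair)
      have y: "((u, w'), l) \<in> U" "\<Psi> ((u, w'), l) = \<iota> w" using \<gamma>[of "\<iota> w"] that * by auto
      then have "l \<ge> 0" using U(3) by auto
      moreover from y(2) have "w' = w" "F (u, w) = 0" "grad_x f0 u w + l *\<^sub>R grad_x F u w = 0"
        by (auto simp: \<Psi>_def \<iota>_def)
      ultimately show ?thesis using stationary_pointI[OF C2(2)] by (auto simp: x_def *)
    qed
    show "u = x w" if "w \<in> W \<inter> \<iota> -` V" "u \<in> stationary_points f0 F w \<inter> X" for w u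
    proof -
      have "(u, w) \<in> N" using that XW by blast
      from N[OF this] that(2)
      have "F (u, w) = 0" "grad_x f0 u w + m (u, w) *\<^sub>R grad_x F u w = 0" "((u, w), m (u, w)) \<in> U"
        by auto
      then have "\<gamma> (\<iota> w) = ((u, w), m (u, w))" using \<gamma>'[of "((u, w), m (u, w))"]
        by (simp add: \<Psi>_def \<iota>_def)
      then show ?thesis by (simp add: x_def)
    qed
    show "norm (x w' - x w) \<le> L * norm (w' - w)"
      if "w \<in> W \<inter> \<iota> -` V" "w' \<in> W \<inter> \<iota> -` V" for w w'
    proof -
      have "norm (x w' - x w) \<le> norm (\<gamma> (\<iota> w') - \<gamma> (\<iota> w))"
        unfolding x_def dist_norm[symmetric] by (rule order_trans[OF dist_fst_le dist_fst_le])
      also have "\<dots> \<le> L * norm (\<iota> w' - \<iota> w)" using L that by blast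
      also have "norm (\<iota> w' - \<iota> w) = norm (w' - w)" by (simp add: \<iota>_def norm_Pair)
      finally show ?thesis .
    qed
  qed (use X \<open>L > 0\<close> in auto)
qed

theorem theorem4p1:
  fixes f0 F :: "(real^'n) \<times> (real^'d) \<Rightarrow> real"
    and xbar :: "real^'n" and wbar :: "real^'d" and lam :: real
    and A1 :: "(real^'n) \<times> real \<Rightarrow> real^'n"
    and A2 :: "(real^'n) \<times> real \<Rightarrow> real^'d"
  assumes "C2 f0" and "C2 F"
    and "xbar \<in> stationary_points f0 F wbar"
    and "F (xbar, wbar) = 0"
    and "grad_x F xbar wbar \<noteq> 0"
    and "lagrange_multiplier f0 F xbar wbar lam" and "lam > 0"
    and "A1 = append_column (hess_xx f0 xbar wbar + lam *\<^sub>R hess_xx F xbar wbar)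
                            (grad_x F xbar wbar)"
    and "A2 = append_column (hess_wx f0 xbar wbar + lam *\<^sub>R hess_wx F xbar wbar)
                            (grad_w F xbar wbar)"
    and "kernel A1 \<inter> kernel A2 \<inter> (kernel (inner (grad_x F xbar wbar)) \<times> UNIV) = {(0, 0)}"
  shows "lipschitz_like_around (stationary_points f0 F) wbar xbar \<longleftrightarrow>
         kernel A1 \<inter> (kernel (inner (grad_x F xbar wbar)) \<times> UNIV) \<subseteq> kernel A2"
proof
  assume "lipschitz_like_around (stationary_points f0 F) wbar xbar"
  from lipschitz_like_imp_kernel_subset[OF assms(1-3,5-7) this]
  show "kernel A1 \<inter> (kernel (inner (grad_x F xbar wbar)) \<times> UNIV) \<subseteq> kernel A2"
    unfolding assms(8,9) kernel_def append_column_def by auto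
next
  assume sub: "kernel A1 \<inter> (kernel (inner (grad_x F xbar wbar)) \<times> UNIV) \<subseteq> kernel A2"
  show "lipschitz_like_around (stationary_points f0 F) wbar xbar"
  proof (rule trivial_kernel_imp_lipschitz_like[OF assms(1,2,4-7)])
    fix v c
    assume "(hess_xx f0 xbar wbar + lam *\<^sub>R hess_xx F xbar wbar) *v v + c *\<^sub>R grad_x F xbar wbar = 0"
      "inner (grad_x F xbar wbar) v = 0"
    then have "(v, c) \<in> kernel A1 \<inter> (kernel (inner (grad_x F xbar wbar)) \<times> UNIV)"
      unfolding assms(8) kernel_def append_column_def by simp
    \<comment> \<open>The inclusion places \<open>(v, c)\<close> in the triple intersection, which
      is trivial by assumption.\<close>
    with sub assms(10) have "(v, c) \<in> {(0, 0)}" by blast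
    then show "v = 0 \<and> c = 0" by simp
  qed
qed

end
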